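(* Let $\Upsilon$, $\pi$ and $t$ be a fixed-point context, a permutation and a nominal term, respectively, and let $\overline c$ be a finite (possibly empty) list of newly quantified atoms. Then $\Upsilon\vdash\mathsf{N}\overline c.\,\pi\curlywedge t$ is derivable if and only if $\Upsilon\vdash\mathsf{N}\overline c.\,\pi\cdot t\stackrel{\curlywedge}{\approx}_\alpha t$ is derivable.
   Context: **Syntax.** Fix a countably infinite set $\mathbb{A}$ of atoms $a,b,c,\dots$ (distinct letters denote distinct atoms), a countably infinite set of variables $X,Y,\dots$, and a countable set of function symbols. A permutation is a bijection $\pi:\mathbb{A}\to\mathbb{A}$ with $\mathrm{supp}(\pi)=\{a\mid\pi(a)\neq a\}$ finite; $(a\ b)$ is a swapping. Nominal terms: $s,t::=a\mid[a]t\mid(t_1,\dots,t_n)\mid f\,t\mid\pi\cdot X$ (not quotiented by $\alpha$-renaming; $X$ abbreviates $Id\cdot X$). Permutation action: $\pi\cdot a=\pi(a)$, $\pi\cdot[a]t=[\pi(a)](\pi\cdot t)$, $\pi\cdot(\pi'\cdot X)=(\pi\circ\pi')\cdot X$, and componentwise on tuples and applications. Conjugate: $\pi^{\rho}=\rho\circ\pi\circ\rho^{-1}$. **Judgements.** A fixed-point context $\Upsilon$ is a finite set of constraints $\pi\curlywedge X$. Put $\mathrm{supp}(\mathrm{perm}(\Upsilon|_X))=\bigcup\{\mathrm{supp}(\pi)\mid\pi\curlywedge X\in\Upsilon\}$. In judgements, $\overline c$ is a finite, possibly empty, list of newly quantified atoms ($\mathsf N$ is the nominal "new" quantifier, omitted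 when $\overline c$ is empty). Rules for $\Upsilon\vdash\mathsf{N}\overline c.\,\pi\curlywedge t$: - $\Upsilon\vdash\mathsf{N}\overline c.\,\pi\curlywedge a$ if $\pi(a)=a$; - $\Upsilon\vdash\mathsf{N}\overline c.\,\pi\curlywedge\pi'\cdot X$ if $\mathrm{supp}(\pi^{\pi'^{-1}})\setminus\{\overline c\}\subseteq\mathrm{supp}(\mathrm{perm}(\Upsilon|_X))$; - from $\Upsilon\vdash\mathsf{N}\overline c.\,\pi\curlywedge t$ infer $\Upsilon\vdash\mathsf{N}\overline c.\,\pi\curlywedge f\,t$; - from $\Upsilon\vdash\mathsf{N}\overline c.\,\pi\curlywedge t_i$ for all $i$ infer $\Upsilon\vdash\mathsf{N}\overline c.\,\pi\curlywedge(t_1,\dots,t_n)$; - from $\Upsilon\vdash\mathsf{N}\overline c,c_1.\,\pi\curlywedge(a\ c_1)\cdot t$ infer $\Upsilon\vdash\mathsf{N}\overline c.\,\pi\curlywedge[a]t$, with $c_1$ a new atom not occurring in the conclusion. Rules for $\Upsilon\vdash\mathsf{N}\overline c.\,s\stackrel{\curlywedge}{\approx}_\alpha t$: - $\Upsilon\vdash\mathsf{N}\overline c.\,a\stackrel{\curlywedge}{\approx}_\alpha a$; - $\Upsilon\vdash\mathsf{N}\overline c.\,\pi\cdot X\stackrel{\curlywedge}{\approx}_\alpha\pi'\cdot X$ if $\mathrm{supp}((\pi')^{-1}\circ\pi)\setminus\{\overline c\}\subseteq\mathrm{supp}(\mathrm{perm}(\Upsilon|_X))$; - congruence (same $\overline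 c$) for $f$, for tuples of the same length, and for abstractions $[a]t,[a]t'$ of the same atom; - from $\Upsilon\vdash\mathsf{N}\overline c.\,s\stackrel{\curlywedge}{\approx}_\alpha(a\ b)\cdot t$ and $\Upsilon\vdash\mathsf{N}\overline c,c_1.\,(a\ c_1)\curlywedge t$ infer $\Upsilon\vdash\mathsf{N}\overline c.\,[a]s\stackrel{\curlywedge}{\approx}_\alpha[b]t$ ($a\neq b$, $c_1$ a new atom not occurring in the conclusion). *)

theory Defs
  imports "HOL-Combinatorics.Perm" "HOL-Library.Countable"
begin

unbundle permutation_syntax

datatype atom = Atom nat

datatype var = Var nat

text \<open>
  Permutations are elements of \<^typ>\<open>atom perm\<close>: multiplication is composition
  (\<open>\<rho> * \<pi>\<close> applies \<open>\<pi>\<close> first), \<^const>\<open>affected\<close> is the support, and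
  \<open>\<langle>a \<leftrightarrow> b\<rangle>\<close> is the swapping of \<open>a\<close> and \<open>b\<close>.
\<close>

definition conjugate :: "'a perm \<Rightarrow> 'a perm \<Rightarrow> 'a perm" where
  "conjugate \<pi> \<rho> = \<rho> * \<pi> * inverse \<rho>"

text \<open>
  Raw nominal terms, not quotiented by renaming of abstracted atoms; the type parameter is the
  set of function symbols. \<open>Susp \<pi> X\<close> is the suspension \<open>\<pi> \<cdot> X\<close>.
\<close>

datatype 'f nterm =
    At atom
  | Abs atom "'f nterm"
  | Tup "'f nterm list"
  | App 'f "'f nterm"
  | Susp "atom perm" var

primrec act :: "atom perm \<Rightarrow> 'f nterm \<Rightarrow> 'f nterm"  (infixr \<open>\<cdot>\<close> 75) where
  "\<pi> \<cdot> At a = At (\<pi> \<langle>$\<rangle> a)"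
| "\<pi> \<cdot> Abs a t = Abs (\<pi> \<langle>$\<rangle> a) (\<pi> \<cdot> t)"
| "\<pi> \<cdot> Tup ts = Tup (map (\<lambda>t. \<pi> \<cdot> t) ts)"
| "\<pi> \<cdot> App f t = App f (\<pi> \<cdot> t)"
| "\<pi> \<cdot> Susp \<pi>' X = Susp (\<pi> * \<pi>') X"

text \<open>
  All atoms occurring in a term, including abstracted ones; the atoms occurring in a permutation
  are those in its support.
\<close>

primrec atoms_of :: "'f nterm \<Rightarrow> atom set" where
  "atoms_of (At a) = {a}"
| "atoms_of (Abs a t) = insert a (atoms_of t)"
| "atoms_of (Tup ts) = (\<Union>A \<in> set (map atoms_of ts). A)"
| "atoms_of (App f t) = atoms_of t"
| "atoms_of (Susp \<pi> X) = affected \<pi>"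

text \<open>A pair \<open>(\<pi>, X)\<close> in a context is the constraint that \<open>\<pi>\<close> fixes \<open>X\<close>.\<close>

type_synonym fp_context = "(atom perm \<times> var) set"

definition restrict_ctx :: "fp_context \<Rightarrow> var \<Rightarrow> fp_context" where
  "restrict_ctx \<Upsilon> X = {(\<pi>, Y) \<in> \<Upsilon>. Y = X}"

definition perms :: "fp_context \<Rightarrow> atom perm set" where
  "perms \<Upsilon> = fst ` \<Upsilon>"

definition supp_perms :: "atom perm set \<Rightarrow> atom set" where
  "supp_perms P = (\<Union>\<pi>\<in>P. affected \<pi>)"

text \<open>
  In both judgements the list \<open>cs\<close> holds the newly quantified atoms. The side condition on \<open>c1\<close>
  in the abstraction rules says that \<open>c1\<close> does not occur anywhere in the conclusion, the context
  and the list of quantified atoms included.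
\<close>

inductive fixed_by :: "fp_context \<Rightarrow> atom list \<Rightarrow> atom perm \<Rightarrow> 'f nterm \<Rightarrow> bool"
    (\<open>_ \<turnstile>\<N> _./ _ \<curlywedge> _\<close> [51, 51, 51, 51] 50)
  for \<Upsilon> :: fp_context where
  fix_atom: "\<pi> \<langle>$\<rangle> a = a \<Longrightarrow> \<Upsilon> \<turnstile>\<N> cs. \<pi> \<curlywedge> At a"
| fix_var: "affected (conjugate \<pi> (inverse \<pi>')) - set cs \<subseteq> supp_perms (perms (restrict_ctx \<Upsilon> X))
    \<Longrightarrow> \<Upsilon> \<turnstile>\<N> cs. \<pi> \<curlywedge> Susp \<pi>' X"
| fix_app: "\<Upsilon> \<turnstile>\<N> cs. \<pi> \<curlywedge> t \<Longrightarrow> \<Upsilon> \<turnstile>\<N> cs. \<pi> \<curlywedge> App f t"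
| fix_tuple: "(\<And>i. i < length ts \<Longrightarrow> \<Upsilon> \<turnstile>\<N> cs. \<pi> \<curlywedge> (ts ! i)) \<Longrightarrow> \<Upsilon> \<turnstile>\<N> cs. \<pi> \<curlywedge> Tup ts"
| fix_abs: "\<lbrakk>\<Upsilon> \<turnstile>\<N> (cs @ [c1]). \<pi> \<curlywedge> (\<langle>a \<leftrightarrow> c1\<rangle> \<cdot> t);
    c1 \<notin> supp_perms (perms \<Upsilon>) \<union> set cs \<union> affected \<pi> \<union> atoms_of (Abs a t)\<rbrakk>
    \<Longrightarrow> \<Upsilon> \<turnstile>\<N> cs. \<pi> \<curlywedge> Abs a t"

inductive alpha_eq :: "fp_context \<Rightarrow> atom list \<Rightarrow> 'f nterm \<Rightarrow> 'f nterm \<Rightarrow> bool"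
    (\<open>_ \<turnstile>\<N> _./ _ \<approx>\<^sub>\<alpha> _\<close> [51, 51, 51, 51] 50)
  for \<Upsilon> :: fp_context where
  alpha_atom: "\<Upsilon> \<turnstile>\<N> cs. At a \<approx>\<^sub>\<alpha> At a"
| alpha_var: "affected (inverse \<pi>' * \<pi>) - set cs \<subseteq> supp_perms (perms (restrict_ctx \<Upsilon> X))
    \<Longrightarrow> \<Upsilon> \<turnstile>\<N> cs. Susp \<pi> X \<approx>\<^sub>\<alpha> Susp \<pi>' X"
| alpha_app: "\<Upsilon> \<turnstile>\<N> cs. s \<approx>\<^sub>\<alpha> t \<Longrightarrow> \<Upsilon> \<turnstile>\<N> cs. App f s \<approx>\<^sub>\<alpha> App f t"
| alpha_tuple: "\<lbrakk>length ss = length ts;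
    \<And>i. i < length ts \<Longrightarrow> \<Upsilon> \<turnstile>\<N> cs. (ss ! i) \<approx>\<^sub>\<alpha> (ts ! i)\<rbrakk>
    \<Longrightarrow> \<Upsilon> \<turnstile>\<N> cs. Tup ss \<approx>\<^sub>\<alpha> Tup ts"
| alpha_abs_same: "\<Upsilon> \<turnstile>\<N> cs. s \<approx>\<^sub>\<alpha> t \<Longrightarrow> \<Upsilon> \<turnstile>\<N> cs. Abs a s \<approx>\<^sub>\<alpha> Abs a t"
| alpha_abs_diff: "\<lbrakk>\<Upsilon> \<turnstile>\<N> cs. s \<approx>\<^sub>\<alpha> (\<langle>a \<leftrightarrow> b\<rangle> \<cdot> t);
    \<Upsilon> \<turnstile>\<N> (cs @ [c1]). \<langle>a \<leftrightarrow> c1\<rangle> \<curlywedge> t;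
    a \<noteq> b;
    c1 \<notin> supp_perms (perms \<Upsilon>) \<union> set cs \<union> atoms_of (Abs a s) \<union> atoms_of (Abs b t)\<rbrakk>
    \<Longrightarrow> \<Upsilon> \<turnstile>\<N> cs. Abs a s \<approx>\<^sub>\<alpha> Abs b t"

end

theory Submission
  imports Defs
begin

text \<open>
  Let \<open>free D t\<close> be the set of atoms that are not fresh for \<open>t\<close> when every variable \<open>X\<close> is assumed
  to have the atoms of \<open>D X\<close> fresh. Both judgements reduce to pointwise conditions on this set:
  \<open>\<pi> \<curlywedge> t\<close> holds iff \<open>\<pi>\<close> fixes every atom of \<open>free D t\<close>, and \<open>\<pi> \<cdot> t \<approx>\<^sub>\<alpha> \<rho> \<cdot> t\<close> holds iff \<open>\<pi>\<close> and \<open>\<rho>\<close>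
  agree on \<open>free D t\<close>, where \<open>D X\<close> consists of the quantified atoms and the support of the
  constraints on \<open>X\<close>. The theorem is the case where \<open>\<rho>\<close> is the identity.
\<close>

primrec free :: "(var \<Rightarrow> atom set) \<Rightarrow> 'f nterm \<Rightarrow> atom set" where
  "free D (At a) = {a}"
| "free D (Abs a t) = free D t - {a}"
| "free D (Tup ts) = (\<Union>A \<in> set (map (free D) ts). A)"
| "free D (App f t) = free D t"
| "free D (Susp \<pi> X) = (\<langle>$\<rangle>) \<pi> ` (- D X)"

definition fresh_for_var :: "fp_context \<Rightarrow> atom list \<Rightarrow> var \<Rightarrow> atom set" where
  "fresh_for_var \<Upsilon> cs X = supp_perms (perms (restrict_ctx \<Upsilon> X)) \<union> set cs"

lemma fresh_for_var_snoc:
  "fresh_for_var \<Upsilon> (cs @ [c]) = (\<lambda>X. insert c (fresh_for_var \<Upsilon> cs X))"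
  by (auto simp: fresh_for_var_def)

declare apply_inj [simp]

lemma inj_apply: "inj ((\<langle>$\<rangle>) \<pi>)"
  by (rule bij_is_inj) simp

lemma apply_swap_eq_if: "\<langle>a \<leftrightarrow> b\<rangle> \<langle>$\<rangle> x = (if x = a then b else if x = b then a else x)"
  by simp

text \<open>With \<open>c\<close> left out of the set, \<open>b\<close> is the only remaining atom
  that the swapping moves. This turns the second premise of \<open>alpha_abs_diff\<close> into a
  freshness condition.\<close>

lemma swap_fixes_iff:
  assumes "c \<noteq> b"
  shows "(\<forall>x \<in> S - {c}. \<langle>b \<leftrightarrow> c\<rangle> \<langle>$\<rangle> x = x) \<longleftrightarrow> b \<notin> S"
  using assms by (auto simp: apply_swap_eq_if)

lemma act_act: "\<pi> \<cdot> \<rho> \<cdot> t = (\<pi> * \<rho>) \<cdot> t"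
  by (induction t) (simp_all add: apply_times mult.assoc)

lemma act_one [simp]: "1 \<cdot> t = t"
  by (induction t) (simp_all add: map_idI)

lemma size_act [simp]: "size (\<pi> \<cdot> t) = size t"
proof (induction t)
  case (Tup ts)
  then have "map (size \<circ> (\<lambda>t. \<pi> \<cdot> t)) ts = map size ts" by simp
  then show ?case by (simp add: size_list_conv_sum_list del: map_eq_conv)
qed simp_all

text \<open>\<open>D\<close> is not renamed: a permutation acting on a suspension composes onto it
  and leaves the variable alone.\<close>

lemma free_act: "free D (\<pi> \<cdot> t) = (\<langle>$\<rangle>) \<pi> ` free D t"
proof (induction t)
  case (Abs a t)
  then show ?case by (simp add: image_set_diff[OF inj_apply])
qed (auto simp: apply_times image_image)

text \<open>Accounts for the atom that the abstraction rules add to the quantified list. In a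
  suspension, \<open>c\<close> is fixed by the permutation, so removing it from the domain removes
  exactly \<open>c\<close> from the image.\<close>

lemma free_insert:
  assumes "c \<notin> atoms_of t"
  shows "free (\<lambda>X. insert c (D X)) t = free D t - {c}"
  using assms
proof (induction t)
  case (Susp \<pi> X)
  then have "\<pi> \<langle>$\<rangle> c = c" by (simp add: in_affected)
  then have "(\<langle>$\<rangle>) \<pi> ` (- D X - {c}) = (\<langle>$\<rangle>) \<pi> ` (- D X) - {c}"
    by (simp add: image_set_diff[OF inj_apply])
  moreover have "- insert c (D X) = - D X - {c}" by auto
  ultimately show ?case by simp
qed auto

lemma finite_atoms_of: "finite (atoms_of t)"
  by (induction t) auto

lemma finite_supp_perms: "finite \<Upsilon> \<Longrightarrow> finite (supp_perms (perms \<Upsilon>))"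
  by (auto simp: supp_perms_def perms_def)

lemma ex_fresh_atom: "finite A \<Longrightarrow> \<exists>c :: atom. c \<notin> A"
proof (rule ex_new_if_finite)
  have "inj Atom" by (rule injI) simp
  then have "infinite (range Atom)" by (simp add: finite_image_iff)
  then show "infinite (UNIV :: atom set)" by (rule infinite_super[rotated]) simp
qed

inductive_simps fixed_by_simps:
  "\<Upsilon> \<turnstile>\<N> cs. \<pi> \<curlywedge> At a"
  "\<Upsilon> \<turnstile>\<N> cs. \<pi> \<curlywedge> Abs a t"
  "\<Upsilon> \<turnstile>\<N> cs. \<pi> \<curlywedge> Tup ts"
  "\<Upsilon> \<turnstile>\<N> cs. \<pi> \<curlywedge> App f t"
  "\<Upsilon> \<turnstile>\<N> cs. \<pi> \<curlywedge> Susp \<pi>' X"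

inductive_simps alpha_eq_simps:
  "\<Upsilon> \<turnstile>\<N> cs. At a \<approx>\<^sub>\<alpha> At b"
  "\<Upsilon> \<turnstile>\<N> cs. Abs a s \<approx>\<^sub>\<alpha> Abs b t"
  "\<Upsilon> \<turnstile>\<N> cs. Tup ss \<approx>\<^sub>\<alpha> Tup ts"
  "\<Upsilon> \<turnstile>\<N> cs. App f s \<approx>\<^sub>\<alpha> App g t"
  "\<Upsilon> \<turnstile>\<N> cs. Susp \<pi> X \<approx>\<^sub>\<alpha> Susp \<pi>' Y"

text \<open>Common form of the side conditions of both variable rules, once the quantified atoms are
  moved into \<open>A\<close>.\<close>

lemma affected_inverse_times_subset_iff:
  "affected (inverse \<rho> * \<pi>) \<subseteq> A \<longleftrightarrow> (\<forall>x \<in> - A. \<pi> \<langle>$\<rangle> x = \<rho> \<langle>$\<rangle> x)"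
proof -
  have "(inverse \<rho> * \<pi>) \<langle>$\<rangle> x = x \<longleftrightarrow> \<pi> \<langle>$\<rangle> x = \<rho> \<langle>$\<rangle> x" for x
  proof -
    have "\<rho> \<langle>$\<rangle> ((inverse \<rho> * \<pi>) \<langle>$\<rangle> x) = \<pi> \<langle>$\<rangle> x"
      by (simp add: apply_times apply_inverse surj_f_inv_f bij_is_surj)
    then show ?thesis by (metis apply_inj)
  qed
  then show ?thesis by (auto simp only: in_affected subset_iff Compl_iff)
qed

lemma fixed_by_iff:
  assumes "finite \<Upsilon>"
  shows "\<Upsilon> \<turnstile>\<N> cs. \<pi> \<curlywedge> t \<longleftrightarrow> (\<forall>x \<in> free (fresh_for_var \<Upsilon> cs) t. \<pi> \<langle>$\<rangle> x = x)"
\<comment> \<open>The premise of \<open>fix_abs\<close> concerns a swapped copy of the body, in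
  general not a subterm but of the same size by \<open>size_act\<close>.\<close>
proof (induction t arbitrary: cs rule: measure_induct_rule[of size])
  case (less t)
  show ?case
  proof (cases t)
    case (Abs a u)
    \<comment> \<open>The right-hand side does not mention \<open>c\<close>, so all sufficiently
      fresh atoms give the same condition and the existential choice of \<open>c1\<close> in the
      rule is harmless.\<close>
    have fresh: "\<Upsilon> \<turnstile>\<N> (cs @ [c]). \<pi> \<curlywedge> (\<langle>a \<leftrightarrow> c\<rangle> \<cdot> u) \<longleftrightarrow>
        (\<forall>x \<in> free (fresh_for_var \<Upsilon> cs) u - {a}. \<pi> \<langle>$\<rangle> x = x)"
      if c: "c \<noteq> a" "c \<notin> atoms_of u" "c \<notin> affected \<pi>" for c
    proof -
      from c(3) have "\<pi> \<langle>$\<rangle> c = c" by (simp add: in_affected)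
      let ?F = "free (fresh_for_var \<Upsilon> cs) u"
      have "\<Upsilon> \<turnstile>\<N> (cs @ [c]). \<pi> \<curlywedge> (\<langle>a \<leftrightarrow> c\<rangle> \<cdot> u) \<longleftrightarrow>
          (\<forall>x \<in> ?F - {c}. \<pi> \<langle>$\<rangle> (\<langle>a \<leftrightarrow> c\<rangle> \<langle>$\<rangle> x) = \<langle>a \<leftrightarrow> c\<rangle> \<langle>$\<rangle> x)"
        using less[of "\<langle>a \<leftrightarrow> c\<rangle> \<cdot> u" "cs @ [c]"] c
        by (simp add: Abs fresh_for_var_snoc free_act free_insert)
      \<comment> \<open>The swapping sends \<open>a\<close> to \<open>c\<close>, which \<pi> fixes,
        so \<open>a\<close> imposes nothing before this step and \<open>c\<close> nothing after it.
        All other atoms are unmoved by the swapping.\<close>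
      also have "\<dots> \<longleftrightarrow> (\<forall>x \<in> ?F - {a}. \<pi> \<langle>$\<rangle> x = x)"
        using c(1) \<open>\<pi> \<langle>$\<rangle> c = c\<close> by (auto simp: apply_swap_eq_if)
      finally show ?thesis .
    qed
    obtain c where "c \<notin> supp_perms (perms \<Upsilon>) \<union> set cs \<union> affected \<pi> \<union> atoms_of (Abs a u)"
      using ex_fresh_atom[of "supp_perms (perms \<Upsilon>) \<union> set cs \<union> affected \<pi> \<union> atoms_of (Abs a u)"]
        finite_supp_perms[OF assms] finite_atoms_of[of "Abs a u"] by auto
    then have "c \<noteq> a" "c \<notin> atoms_of u" "c \<notin> affected \<pi>" "c \<notin> supp_perms (perms \<Upsilon>)" "c \<notin> set cs"
      by auto
    then show ?thesis
      unfolding Abs fixed_by_simps free.simps using fresh by blast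
  next
    case (Tup ts)
    then have "\<Upsilon> \<turnstile>\<N> cs. \<pi> \<curlywedge> u \<longleftrightarrow> (\<forall>x \<in> free (fresh_for_var \<Upsilon> cs) u. \<pi> \<langle>$\<rangle> x = x)"
      if "u \<in> set ts" for u
      using that by (intro less) (simp add: less_Suc_eq_le size_list_estimation')
    moreover have "\<Upsilon> \<turnstile>\<N> cs. \<pi> \<curlywedge> t \<longleftrightarrow> (\<forall>u \<in> set ts. \<Upsilon> \<turnstile>\<N> cs. \<pi> \<curlywedge> u)"
      by (simp add: Tup fixed_by_simps all_set_conv_all_nth)
    ultimately show ?thesis
      by (auto simp: Tup)
  next
    case (Susp \<pi>' X)
    \<comment> \<open>The conjugate unfolds to \<open>inverse \<pi>' * \<pi> * \<pi>'\<close>, so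
      the condition compares \<open>\<pi> * \<pi>'\<close> with \<open>\<pi>'\<close>.\<close>
    have "\<Upsilon> \<turnstile>\<N> cs. \<pi> \<curlywedge> t \<longleftrightarrow>
        affected (inverse \<pi>' * (\<pi> * \<pi>')) \<subseteq> fresh_for_var \<Upsilon> cs X"
      by (auto simp: Susp fixed_by_simps fresh_for_var_def conjugate_def mult.assoc)
    then show ?thesis
      by (simp add: affected_inverse_times_subset_iff apply_times Susp)
  next
    case (App f u)
    with less[of u cs] show ?thesis by (simp add: fixed_by_simps)
  qed (simp add: fixed_by_simps)
qed

text \<open>Allowing any \<rho> makes structural induction work: the swapping that
  \<open>alpha_abs_diff\<close> puts before the right body is absorbed into \<rho>. The premise with
  the longer list is a fixed-point judgement, settled by \<open>fixed_by_iff\<close>, so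
  \<open>cs\<close> stays fixed.\<close>

lemma alpha_eq_act_iff:
  assumes "finite \<Upsilon>"
  shows "\<Upsilon> \<turnstile>\<N> cs. (\<pi> \<cdot> t) \<approx>\<^sub>\<alpha> (\<rho> \<cdot> t) \<longleftrightarrow>
    (\<forall>x \<in> free (fresh_for_var \<Upsilon> cs) t. \<pi> \<langle>$\<rangle> x = \<rho> \<langle>$\<rangle> x)"
proof (induction t arbitrary: \<rho>)
  case (At a)
  then show ?case by (auto simp: alpha_eq_simps)
next
  case (Abs a t)
  let ?F = "free (fresh_for_var \<Upsilon> cs) t"
  let ?b = "\<pi> \<langle>$\<rangle> a"
  let ?d = "\<rho> \<langle>$\<rangle> a"
  show ?case
  proof (cases "?b = ?d")
    case True
    then show ?thesis using Abs by (auto simp: alpha_eq_simps)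
  next
    case False
    let ?A = "supp_perms (perms \<Upsilon>) \<union> set cs \<union> atoms_of (Abs ?b (\<pi> \<cdot> t)) \<union>
      atoms_of (Abs ?d (\<rho> \<cdot> t))"
    have fresh: "\<Upsilon> \<turnstile>\<N> (cs @ [c]). \<langle>?b \<leftrightarrow> c\<rangle> \<curlywedge> (\<rho> \<cdot> t) \<longleftrightarrow> ?b \<notin> (\<langle>$\<rangle>) \<rho> ` ?F" 
      if c: "c \<noteq> ?b" "c \<notin> atoms_of (\<rho> \<cdot> t)" for c
    proof -
      have "\<Upsilon> \<turnstile>\<N> (cs @ [c]). \<langle>?b \<leftrightarrow> c\<rangle> \<curlywedge> (\<rho> \<cdot> t) \<longleftrightarrow>
          (\<forall>x \<in> (\<langle>$\<rangle>) \<rho> ` ?F - {c}. \<langle>?b \<leftrightarrow> c\<rangle> \<langle>$\<rangle> x = x)"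
        unfolding fixed_by_iff[OF assms] fresh_for_var_snoc free_insert[OF c(2)]
        unfolding free_act ..
      also have "\<dots> \<longleftrightarrow> ?b \<notin> (\<langle>$\<rangle>) \<rho> ` ?F"
        using c(1) by (rule swap_fixes_iff)
      finally show ?thesis .
    qed
    obtain c where "c \<notin> ?A"
      using ex_fresh_atom[of ?A] finite_supp_perms[OF assms] finite_atoms_of[of "Abs ?b (\<pi> \<cdot> t)"]
        finite_atoms_of[of "Abs ?d (\<rho> \<cdot> t)"] by auto
    then have c: "c \<noteq> ?b" "c \<notin> atoms_of (\<rho> \<cdot> t)" "c \<notin> ?A"
      by auto
    have "\<Upsilon> \<turnstile>\<N> cs. (\<pi> \<cdot> Abs a t) \<approx>\<^sub>\<alpha> (\<rho> \<cdot> Abs a t) \<longleftrightarrow>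
        \<Upsilon> \<turnstile>\<N> cs. (\<pi> \<cdot> t) \<approx>\<^sub>\<alpha> (\<langle>?b \<leftrightarrow> ?d\<rangle> \<cdot> \<rho> \<cdot> t) \<and> ?b \<notin> (\<langle>$\<rangle>) \<rho> ` ?F"
      (is "?lhs \<longleftrightarrow> ?rhs")
    proof
      assume ?lhs
      with False obtain c1 where "\<Upsilon> \<turnstile>\<N> cs. (\<pi> \<cdot> t) \<approx>\<^sub>\<alpha> (\<langle>?b \<leftrightarrow> ?d\<rangle> \<cdot> \<rho> \<cdot> t)"
        "\<Upsilon> \<turnstile>\<N> (cs @ [c1]). \<langle>?b \<leftrightarrow> c1\<rangle> \<curlywedge> (\<rho> \<cdot> t)" "c1 \<noteq> ?b" "c1 \<notin> atoms_of (\<rho> \<cdot> t)"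
        by (auto simp: alpha_eq_simps)
      then show ?rhs using fresh[of c1] by simp
    next
      assume rhs: ?rhs
      with c have "\<Upsilon> \<turnstile>\<N> (cs @ [c]). \<langle>?b \<leftrightarrow> c\<rangle> \<curlywedge> (\<rho> \<cdot> t)" using fresh[of c] by simp
      with rhs False c(3) show ?lhs
        unfolding act.simps by (intro alpha_eq.alpha_abs_diff[of _ _ _ _ _ _ c]) simp_all
    qed
    also have "\<dots> \<longleftrightarrow>
        (\<forall>x \<in> ?F. \<pi> \<langle>$\<rangle> x = \<langle>?b \<leftrightarrow> ?d\<rangle> \<langle>$\<rangle> (\<rho> \<langle>$\<rangle> x)) \<and> ?b \<notin> (\<langle>$\<rangle>) \<rho> ` ?F"
      by (simp add: act_act Abs apply_times)
    \<comment> \<open>\<rho> reaches \<open>?d\<close> only at \<open>a\<close>, where the swapping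
      returns \<open>?b\<close>, the value of \<pi> at \<open>a\<close>; elsewhere on
      \<open>?F\<close> the swapping does nothing, as \<open>?b\<close> is not reached. Conversely,
      an atom of \<open>?F\<close> sent to \<open>?b\<close> by \<rho> would differ from
      \<open>a\<close> and have the same image as \<open>a\<close> under \<pi>.\<close>
    also have "\<dots> \<longleftrightarrow> (\<forall>x \<in> ?F - {a}. \<pi> \<langle>$\<rangle> x = \<rho> \<langle>$\<rangle> x)"
    proof (intro iffI conjI ballI notI)
      fix x
      assume *: "(\<forall>x \<in> ?F. \<pi> \<langle>$\<rangle> x = \<langle>?b \<leftrightarrow> ?d\<rangle> \<langle>$\<rangle> (\<rho> \<langle>$\<rangle> x)) \<and> ?b \<notin> (\<langle>$\<rangle>) \<rho> ` ?F"
        and x: "x \<in> ?F - {a}"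
      from x have "\<rho> \<langle>$\<rangle> x \<noteq> ?d" by auto
      moreover from * x have "\<rho> \<langle>$\<rangle> x \<noteq> ?b" by force
      ultimately show "\<pi> \<langle>$\<rangle> x = \<rho> \<langle>$\<rangle> x" using * x by (simp add: apply_swap_eq_if)
    next
      fix x
      assume *: "\<forall>x \<in> ?F - {a}. \<pi> \<langle>$\<rangle> x = \<rho> \<langle>$\<rangle> x" and x: "x \<in> ?F"
      show "\<pi> \<langle>$\<rangle> x = \<langle>?b \<leftrightarrow> ?d\<rangle> \<langle>$\<rangle> (\<rho> \<langle>$\<rangle> x)"
      proof (cases "x = a")
        case False
        with * x have "\<rho> \<langle>$\<rangle> x = \<pi> \<langle>$\<rangle> x" by simp
        moreover from this False have "\<rho> \<langle>$\<rangle> x \<noteq> ?b" by simp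
        moreover from False have "\<rho> \<langle>$\<rangle> x \<noteq> ?d" by simp
        ultimately show ?thesis by (simp add: apply_swap_eq_if)
      qed (simp add: apply_swap_eq_if)
    next
      assume *: "\<forall>x \<in> ?F - {a}. \<pi> \<langle>$\<rangle> x = \<rho> \<langle>$\<rangle> x" and "?b \<in> (\<langle>$\<rangle>) \<rho> ` ?F"
      then obtain x where x: "x \<in> ?F" "?b = \<rho> \<langle>$\<rangle> x" by auto
      with \<open>?b \<noteq> ?d\<close> have "x \<noteq> a" by auto
      with * x have "\<pi> \<langle>$\<rangle> x = ?b" by simp
      with \<open>x \<noteq> a\<close> show False by simp
    qed
    finally show ?thesis by simp
  qed
next
  case (Tup ts)
  have "\<Upsilon> \<turnstile>\<N> cs. (\<pi> \<cdot> Tup ts) \<approx>\<^sub>\<alpha> (\<rho> \<cdot> Tup ts) \<longleftrightarrow>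
      (\<forall>t \<in> set ts. \<Upsilon> \<turnstile>\<N> cs. (\<pi> \<cdot> t) \<approx>\<^sub>\<alpha> (\<rho> \<cdot> t))"
    by (simp add: alpha_eq_simps all_set_conv_all_nth)
  then show ?case using Tup by auto
next
  case (App f t)
  then show ?case by (auto simp: alpha_eq_simps)
next
  case (Susp \<pi>' X)
  have "\<Upsilon> \<turnstile>\<N> cs. (\<pi> \<cdot> Susp \<pi>' X) \<approx>\<^sub>\<alpha> (\<rho> \<cdot> Susp \<pi>' X) \<longleftrightarrow>
      affected (inverse (\<rho> * \<pi>') * (\<pi> * \<pi>')) \<subseteq> fresh_for_var \<Upsilon> cs X"
    by (auto simp: alpha_eq_simps fresh_for_var_def)
  \<comment> \<open>The inverse of the product is kept intact so that
    \<open>affected_inverse_times_subset_iff\<close> matches with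
    \<open>\<rho> * \<pi>'\<close>.\<close>
  then show ?case
    by (simp add: affected_inverse_times_subset_iff apply_times del: perm.inverse_distrib_swap)
qed

theorem theorem3p12:
  fixes \<Upsilon> :: fp_context and \<pi> :: "atom perm" and t :: "'f::countable nterm"
    and cs :: "atom list"
  assumes "finite \<Upsilon>"
  shows "\<Upsilon> \<turnstile>\<N> cs. \<pi> \<curlywedge> t \<longleftrightarrow> \<Upsilon> \<turnstile>\<N> cs. (\<pi> \<cdot> t) \<approx>\<^sub>\<alpha> t"
  using alpha_eq_act_iff[OF assms, of cs \<pi> t 1] fixed_by_iff[OF assms, of cs \<pi> t] by simp

end
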